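(* Take a system of fermions on a lattice with finitely many sites, with annihilation operators $a_{\vec n}$, that evolves via the causal fermionic unitary $U_A$. Add a copy of the system with annihilation operators $b_{\vec n}$, and consider the evolution of the two copies via $U_AU_B^\dagger$, where $U_B$ is equivalent to $U_A$ but acts on the copy fermions. Then this evolution can be decomposed into local fermionic unitaries: $$U_AU_B^\dagger=\prod_{\vec n}S_{\vec n}\prod_{\vec m}\left[U_BS_{\vec m}U_B^\dagger\right],$$ where $$S_{\vec n}=\exp\left[i\tfrac{\pi}{2}(b_{\vec n}^\dagger-a_{\vec n}^\dagger)(b_{\vec n}-a_{\vec n})\right]$$ is the on-site swap of the modes $a_{\vec n}$ and $b_{\vec n}$, and the $U_BS_{\vec m}U_B^\dagger$ are local fermionic unitaries that commute with one another.
   Context: All $a_{\vec n},b_{\vec m}$ jointly satisfy the canonical anticommutation relations, $\{a_{\vec n},a_{\vec m}^\dagger\}=\{b_{\vec n},b_{\vec m}^\dagger\}=\delta_{\vec n\vec m}$, all other anticommutators among the $a,a^\dagger,b,b^\dagger$ being zero; the modes $a_{\vec n}$ and $b_{\vec n}$ live at the same site $\vec n$. $U_B$ is obtained from the expression of $U_A$ in terms of $a_{\vec n},a_{\vec n}^\dagger$ by replacing each $a_{\vec n}$ by $b_{\vec n}$. An operator is localized on a region if it can be written in terms of creation and annihilation operators (of both copies) from sites of that region only. A unitary $U$ is fermionic if, on adding an ancillary fermionic mode with annihilation operator $c$ (anticommuting with all others), $U^\dagger cU=c$. $U_A$ is causal if there is $L\ge0$ such that for each $\vec n$, $U_A^\dagger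 a_{\vec n}U_A$ is localized on sites $\vec m$ with $|\vec n-\vec m|<L$. Local means: $S_{\vec n}$ is localized on the single site $\vec n$, and $U_BS_{\vec m}U_B^\dagger$ is localized on sites $\vec k$ with $|\vec k-\vec m|<L$. *)

theory Defs
  imports "HOL-Analysis.Analysis"
begin

text \<open>
  Operators are complex square matrices acting on the finite-dimensional Hilbert space
  \<open>complex ^ 'h\<close>.  This space carries the modes of both copies of the system together with the
  ancillary mode; it need not be the Fock space itself, any representation of the canonical
  anticommutation relations is allowed.  The scalar operator \<open>z\<close> is \<open>mat z\<close>.
\<close>

type_synonym 'h op = "complex ^ 'h ^ 'h"

definition hconj :: "('h::finite) op \<Rightarrow> 'h op"  ("_\<^sup>\<dagger>" [1000] 1000)
  where "A\<^sup>\<dagger> = (\<chi> i j. cnj (A $ j $ i))"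

definition acomm :: "('h::finite) op \<Rightarrow> 'h op \<Rightarrow> 'h op"
  where "acomm A B = A ** B + B ** A"

definition unitary_op :: "('h::finite) op \<Rightarrow> bool"
  where "unitary_op U \<longleftrightarrow> U\<^sup>\<dagger> ** U = mat 1 \<and> U ** U\<^sup>\<dagger> = mat 1"

text \<open>
  The library's \<open>exp\<close> requires a normed algebra, whereas multiplication \<open>*\<close> on the type
  \<open>complex ^ 'h ^ 'h\<close> is entrywise; hence the exponential series is written out for \<open>**\<close>.
\<close>

definition op_exp :: "('h::finite) op \<Rightarrow> 'h op"
  where "op_exp A = (\<Sum>k. (1 / fact k) *\<^sub>R (((**) A ^^ k) (mat 1)))"

definition op_prod :: "('h::finite) op list \<Rightarrow> 'h op"
  where "op_prod As = foldr (**) As (mat 1)"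


definition CAR :: "'m set \<Rightarrow> ('m \<Rightarrow> ('h::finite) op) \<Rightarrow> bool"
  where "CAR M f \<longleftrightarrow> (\<forall>i\<in>M. \<forall>j\<in>M.
           acomm (f i) (f j)\<^sup>\<dagger> = (if i = j then mat 1 else 0) \<and>
           acomm (f i) (f j) = 0 \<and>
           acomm (f i)\<^sup>\<dagger> (f j)\<^sup>\<dagger> = 0)"

text \<open>
  The modes of the two copies are indexed by the disjoint sum \<open>\<Lambda> <+> \<Lambda>\<close>, and
  \<open>case_sum a b\<close> sends \<open>Inl n\<close> to \<open>a n\<close> and \<open>Inr n\<close> to \<open>b n\<close>.
\<close>

definition two_copies :: "'s set \<Rightarrow> ('s \<Rightarrow> ('h::finite) op) \<Rightarrow> ('s \<Rightarrow> 'h op) \<Rightarrow> bool"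
  where "two_copies \<Lambda> a b \<longleftrightarrow> CAR (\<Lambda> <+> \<Lambda>) (case_sum a b)"

definition ancilla :: "'s set \<Rightarrow> ('s \<Rightarrow> ('h::finite) op) \<Rightarrow> ('s \<Rightarrow> 'h op) \<Rightarrow> 'h op \<Rightarrow> bool"
  where "ancilla \<Lambda> a b c \<longleftrightarrow>
           acomm c c\<^sup>\<dagger> = mat 1 \<and> acomm c c = 0 \<and>
           (\<forall>n\<in>\<Lambda>. acomm c (a n) = 0 \<and> acomm c (a n)\<^sup>\<dagger> = 0 \<and>
                   acomm c (b n) = 0 \<and> acomm c (b n)\<^sup>\<dagger> = 0)"

definition fermionic :: "('h::finite) op \<Rightarrow> 'h op \<Rightarrow> bool"
  where "fermionic c U \<longleftrightarrow> U\<^sup>\<dagger> ** c ** U = c"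


text \<open>
  Formal expressions in annihilation and creation operators of modes in \<open>'m\<close>; \<open>set_expr e\<close> is
  the set of modes occurring in \<open>e\<close>.  Replacing each \<open>a n\<close> by \<open>b n\<close> in an expression \<open>e\<close> means
  passing from \<open>eval_expr a e\<close> to \<open>eval_expr b e\<close>.
\<close>

datatype (set_expr: 'm) expr =
    Scalar complex
  | Ann 'm
  | Cre 'm
  | Add "'m expr" "'m expr"
  | Mul "'m expr" "'m expr"

primrec eval_expr :: "('m \<Rightarrow> ('h::finite) op) \<Rightarrow> 'm expr \<Rightarrow> 'h op" where
  "eval_expr f (Scalar z) = mat z"
| "eval_expr f (Ann i) = f i"
| "eval_expr f (Cre i) = (f i)\<^sup>\<dagger>"
| "eval_expr f (Add e e') = eval_expr f e + eval_expr f e'"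
| "eval_expr f (Mul e e') = eval_expr f e ** eval_expr f e'"

definition localized :: "('s \<Rightarrow> ('h::finite) op) \<Rightarrow> ('s \<Rightarrow> 'h op) \<Rightarrow> 's set \<Rightarrow> 'h op \<Rightarrow> bool"
  where "localized a b R X \<longleftrightarrow>
           (\<exists>e. set_expr e \<subseteq> R <+> R \<and> X = eval_expr (case_sum a b) e)"

definition causal_range ::
    "'s set \<Rightarrow> ('s \<Rightarrow> 's \<Rightarrow> real) \<Rightarrow> ('s \<Rightarrow> ('h::finite) op) \<Rightarrow> ('s \<Rightarrow> 'h op) \<Rightarrow> real \<Rightarrow> 'h op \<Rightarrow> bool"
  where "causal_range \<Lambda> d a b L U \<longleftrightarrow>
           0 \<le> L \<and> (\<forall>n\<in>\<Lambda>. localized a b {m \<in> \<Lambda>. d n m < L} (U\<^sup>\<dagger> ** a n ** U))"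

definition site_swap :: "('s \<Rightarrow> ('h::finite) op) \<Rightarrow> ('s \<Rightarrow> 'h op) \<Rightarrow> 's \<Rightarrow> 'h op"
  where "site_swap a b n =
           op_exp (mat (\<i> * of_real (pi / 2)) ** (((b n)\<^sup>\<dagger> - (a n)\<^sup>\<dagger>) ** (b n - a n)))"

text \<open>\<open>S\<close> exchanges the modes \<open>a n\<close> and \<open>b n\<close> and leaves the modes at all other sites alone.\<close>

definition swaps_modes_at ::
    "'s set \<Rightarrow> ('s \<Rightarrow> ('h::finite) op) \<Rightarrow> ('s \<Rightarrow> 'h op) \<Rightarrow> 's \<Rightarrow> 'h op \<Rightarrow> bool"
  where "swaps_modes_at \<Lambda> a b n S \<longleftrightarrow>
           S\<^sup>\<dagger> ** a n ** S = b n \<and> S\<^sup>\<dagger> ** b n ** S = a n \<and>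
           (\<forall>k\<in>\<Lambda> - {n}. S\<^sup>\<dagger> ** a k ** S = a k \<and> S\<^sup>\<dagger> ** b k ** S = b k)"

end

theory Submission
  imports Defs "HOL-Library.Multiset"
begin

text \<open>
  With \<open>D = b\<^sub>n - a\<^sub>n\<close>, half of \<open>D\<^sup>\<dagger> D\<close> is a projection, so \<open>S\<^sub>n = 1 - D\<^sup>\<dagger> D\<close> is a self-adjoint
  unitary that negates \<open>D\<close> and fixes \<open>a\<^sub>n + b\<^sub>n\<close>.  The product \<open>T\<close> of all \<open>S\<^sub>n\<close> exchanges the two
  copies, hence \<open>U\<^sub>A = T U\<^sub>B T\<^sup>\<dagger>\<close> and \<open>U\<^sub>A U\<^sub>B\<^sup>\<dagger> = T (U\<^sub>B T U\<^sub>B\<^sup>\<dagger>)\<close>.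

  Locality of \<open>V\<^sub>m = U\<^sub>B S\<^sub>m U\<^sub>B\<^sup>\<dagger>\<close> needs the causality of the inverse evolution.  If \<open>k\<close> is at distance
  at least \<open>L\<close> from \<open>m\<close>, then \<open>U\<^sub>B\<^sup>\<dagger> b\<^sub>k U\<^sub>B\<close> is localized away from \<open>m\<close> and so commutes with \<open>S\<^sub>m\<close>;
  thus \<open>V\<^sub>m\<close> commutes with all modes outside the region.  Being fermionic, \<open>V\<^sub>m\<close> is even, and an even
  operator that commutes with all modes outside a region is localized in it.
\<close>

section \<open>Operator algebra\<close>

lemma op_add_rdistrib: "(A + B) ** C = A ** C + B ** C" for A B C :: "('h::finite) op"
  by (simp add: matrix_matrix_mult_def vec_eq_iff sum.distrib algebra_simps)

lemma op_diff_ldistrib: "A ** (B - C) = A ** B - A ** C" for A B C :: "('h::finite) op"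
  by (simp add: matrix_matrix_mult_def vec_eq_iff sum_subtractf algebra_simps)

lemma op_diff_rdistrib: "(A - B) ** C = A ** C - B ** C" for A B C :: "('h::finite) op"
  by (simp add: matrix_matrix_mult_def vec_eq_iff sum_subtractf algebra_simps)

lemma op_minus_left: "(- A) ** B = - (A ** B)" for A B :: "('h::finite) op"
  by (simp add: matrix_matrix_mult_def vec_eq_iff sum_negf)

lemma op_minus_right: "A ** (- B) = - (A ** B)" for A B :: "('h::finite) op"
  by (simp add: matrix_matrix_mult_def vec_eq_iff sum_negf)

lemma op_zero_left [simp]: "0 ** B = 0" for B :: "('h::finite) op"
  by (simp add: matrix_matrix_mult_def vec_eq_iff)

lemma op_zero_right [simp]: "A ** 0 = 0" for A :: "('h::finite) op"
  by (simp add: matrix_matrix_mult_def vec_eq_iff)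

lemmas op_distribs = matrix_add_ldistrib op_add_rdistrib op_diff_ldistrib op_diff_rdistrib
  op_minus_left op_minus_right

lemma mat_op_left: "mat z ** A = (\<chi> i j. z * A $ i $ j)" for A :: "('h::finite) op"
  by (simp add: matrix_matrix_mult_def mat_def vec_eq_iff if_distrib if_distribR cong: if_cong)

lemma mat_op_right: "A ** mat z = (\<chi> i j. z * A $ i $ j)" for A :: "('h::finite) op"
  by (simp add: matrix_matrix_mult_def mat_def vec_eq_iff if_distrib if_distribR mult.commute
      cong: if_cong)

lemma mat_central: "mat z ** A = A ** mat z" for A :: "('h::finite) op"
  by (simp add: mat_op_left mat_op_right)

lemma mat_mult: "mat z ** mat w = (mat (z * w) :: ('h::finite) op)"
  by (subst mat_op_left) (simp add: mat_def vec_eq_iff)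

lemma mat_minus_one: "mat (- 1) ** A = - A" for A :: "('h::finite) op"
  by (simp add: mat_op_left vec_eq_iff)

lemma mat_neq_0: "mat 1 \<noteq> (0 :: ('h::finite) op)"
  by (auto simp: mat_def vec_eq_iff)

lemma op_double_eq_iff: "A + A = B + B \<longleftrightarrow> A = B" for A B :: "('h::finite) op"
  by (auto simp: vec_eq_iff)

lemma op_double_eq_0_iff: "A + A = 0 \<longleftrightarrow> A = 0" for A :: "('h::finite) op"
  using op_double_eq_iff[of A 0] by simp

lemma hconj_hconj [simp]: "(A\<^sup>\<dagger>)\<^sup>\<dagger> = A" for A :: "('h::finite) op"
  by (simp add: hconj_def vec_eq_iff)

lemma hconj_mult [simp]: "(A ** B)\<^sup>\<dagger> = B\<^sup>\<dagger> ** A\<^sup>\<dagger>" for A B :: "('h::finite) op"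
  by (simp add: hconj_def matrix_matrix_mult_def vec_eq_iff mult.commute)

lemma hconj_add [simp]: "(A + B)\<^sup>\<dagger> = A\<^sup>\<dagger> + B\<^sup>\<dagger>" for A B :: "('h::finite) op"
  by (simp add: hconj_def vec_eq_iff)

lemma hconj_diff [simp]: "(A - B)\<^sup>\<dagger> = A\<^sup>\<dagger> - B\<^sup>\<dagger>" for A B :: "('h::finite) op"
  by (simp add: hconj_def vec_eq_iff)

lemma hconj_mat [simp]: "(mat z)\<^sup>\<dagger> = (mat (cnj z) :: ('h::finite) op)"
  by (simp add: hconj_def mat_def vec_eq_iff)

lemma hconj_0 [simp]: "0\<^sup>\<dagger> = (0 :: ('h::finite) op)"
  by (simp add: hconj_def vec_eq_iff)

lemma acomm_commute: "acomm A B = acomm B A"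
  by (simp add: acomm_def add.commute)

lemma acomm_eq_0_iff: "acomm A B = 0 \<longleftrightarrow> A ** B = - (B ** A)"
  by (simp add: acomm_def eq_neg_iff_add_eq_0)

lemma hconj_acomm: "(acomm A B)\<^sup>\<dagger> = acomm A\<^sup>\<dagger> B\<^sup>\<dagger>"
  by (simp add: acomm_def add.commute)

lemma acomm_add_right: "acomm A (B + C) = acomm A B + acomm A C"
  by (simp add: acomm_def op_distribs)

lemma acomm_diff_right: "acomm A (B - C) = acomm A B - acomm A C"
  by (simp add: acomm_def op_distribs)

lemma acomm_add_left: "acomm (A + B) C = acomm A C + acomm B C"
  by (simp add: acomm_def op_distribs)

lemma acomm_diff_left: "acomm (A - B) C = acomm A C - acomm B C"
  by (simp add: acomm_def op_distribs)

lemmas acomm_linear = acomm_add_right acomm_diff_right acomm_add_left acomm_diff_left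

section \<open>Commutation and conjugation by unitaries\<close>

lemma commute_mult:
  fixes X A B :: "('h::finite) op"
  assumes "X ** A = A ** X" "X ** B = B ** X"
  shows "X ** (A ** B) = (A ** B) ** X"
  using assms by (metis matrix_mul_assoc)

text \<open>Each factor passed costs a sign, and the two signs cancel.\<close>

lemma acomm_0_mult_commute:
  fixes X A B :: "('h::finite) op"
  assumes "acomm X A = 0" "acomm X B = 0"
  shows "X ** (A ** B) = (A ** B) ** X"
proof -
  have "X ** (A ** B) = - (A ** X) ** B"
    using assms(1) by (simp add: acomm_eq_0_iff matrix_mul_assoc)
  also have "\<dots> = - (A ** (X ** B))" by (simp add: op_minus_left matrix_mul_assoc)
  also have "\<dots> = (A ** B) ** X"
    using assms(2) by (simp add: acomm_eq_0_iff matrix_mul_assoc op_minus_right)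
  finally show ?thesis .
qed

lemma unitary_op_hconj: "unitary_op U \<Longrightarrow> unitary_op U\<^sup>\<dagger>"
  by (auto simp: unitary_op_def)

lemma unitary_cancel:
  assumes "unitary_op U"
  shows "U\<^sup>\<dagger> ** U = mat 1" "U ** U\<^sup>\<dagger> = mat 1" "U\<^sup>\<dagger> ** (U ** X) = X" "U ** (U\<^sup>\<dagger> ** X) = X"
  using assms by (auto simp: unitary_op_def matrix_mul_assoc)

lemma unitary_op_mult:
  assumes "unitary_op U" "unitary_op V"
  shows "unitary_op (U ** V)"
  by (simp add: unitary_op_def matrix_mul_assoc[symmetric] unitary_cancel[OF assms(1)]
      unitary_cancel[OF assms(2)])

lemma unitary_conj_eq_iff:
  assumes "unitary_op U"
  shows "U\<^sup>\<dagger> ** X ** U = Y \<longleftrightarrow> X ** U = U ** Y"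
  by (auto simp: unitary_cancel[OF assms] matrix_mul_assoc[symmetric])

lemma unitary_conj_inject:
  assumes "unitary_op U"
  shows "U\<^sup>\<dagger> ** X ** U = U\<^sup>\<dagger> ** Y ** U \<longleftrightarrow> X = Y"
proof
  assume "U\<^sup>\<dagger> ** X ** U = U\<^sup>\<dagger> ** Y ** U"
  then have "U ** (U\<^sup>\<dagger> ** X ** U) ** U\<^sup>\<dagger> = U ** (U\<^sup>\<dagger> ** Y ** U) ** U\<^sup>\<dagger>"
    by simp
  then show "X = Y"
    by (simp add: unitary_cancel[OF assms] matrix_mul_assoc[symmetric])
qed simp

lemma unitary_hconj_commute:
  assumes "unitary_op U" "X ** U = U ** X"
  shows "X ** U\<^sup>\<dagger> = U\<^sup>\<dagger> ** X"
proof -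
  have "X ** U\<^sup>\<dagger> = U\<^sup>\<dagger> ** (U ** X) ** U\<^sup>\<dagger>"
    by (simp add: unitary_cancel[OF assms(1)] matrix_mul_assoc)
  then show ?thesis
    by (simp add: assms(2)[symmetric] unitary_cancel[OF assms(1)] matrix_mul_assoc[symmetric])
qed

lemma unitary_conj_mult:
  assumes "unitary_op U"
  shows "U\<^sup>\<dagger> ** (X ** Y) ** U = (U\<^sup>\<dagger> ** X ** U) ** (U\<^sup>\<dagger> ** Y ** U)"
  by (simp add: unitary_cancel[OF assms] matrix_mul_assoc[symmetric])

lemma hconj_conj: "(U\<^sup>\<dagger> ** X ** U)\<^sup>\<dagger> = U\<^sup>\<dagger> ** X\<^sup>\<dagger> ** U"
  by (simp add: matrix_mul_assoc)

lemma fermionic_commute: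
  assumes "unitary_op U" "fermionic c U"
  shows "c ** U = U ** c" "c\<^sup>\<dagger> ** U = U ** c\<^sup>\<dagger>"
proof -
  show "c ** U = U ** c"
    using assms by (simp add: fermionic_def unitary_conj_eq_iff)
  have "U\<^sup>\<dagger> ** c\<^sup>\<dagger> ** U = c\<^sup>\<dagger>"
    using assms(2) hconj_conj[of U c] by (simp add: fermionic_def)
  then show "c\<^sup>\<dagger> ** U = U ** c\<^sup>\<dagger>"
    using assms(1) by (simp add: unitary_conj_eq_iff)
qed

section \<open>Ordered products\<close>

lemma op_prod_Nil [simp]: "op_prod [] = mat 1"
  by (simp add: op_prod_def)

lemma op_prod_Cons [simp]: "op_prod (A # As) = A ** op_prod As"
  by (simp add: op_prod_def)

lemma op_prod_append [simp]: "op_prod (As @ Bs) = op_prod As ** op_prod Bs"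
  by (induction As) (simp_all add: matrix_mul_assoc)

lemma op_prod_commute:
  assumes "\<And>A. A \<in> set As \<Longrightarrow> X ** A = A ** X"
  shows "X ** op_prod As = op_prod As ** X"
  using assms by (induction As) (auto intro: commute_mult)

text \<open>The head of one list is located in the other and moved to its front past factors that
  commute with it. Products over the sites thus do not depend on the enumeration.\<close>

lemma op_prod_permute:
  fixes f :: "'i \<Rightarrow> ('h::finite) op"
  assumes "mset xs = mset ys"
    and "\<And>x y. x \<in> set xs \<Longrightarrow> y \<in> set xs \<Longrightarrow> f x ** f y = f y ** f x"
  shows "op_prod (map f xs) = op_prod (map f ys)"
  using assms
proof (induction xs arbitrary: ys)
  case Nil
  then show ?case by simp
next
  case (Cons x xs)
  have "x \<in> set ys"
    using Cons.prems(1) by (metis list.set_intros(1) set_mset_mset)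
  then obtain us vs where ys: "ys = us @ x # vs"
    by (meson split_list)
  have "op_prod (map f xs) = op_prod (map f (us @ vs))"
    using Cons.prems ys by (intro Cons.IH) auto
  moreover have "f x ** op_prod (map f us) = op_prod (map f us) ** f x"
  proof (rule op_prod_commute)
    fix A assume "A \<in> set (map f us)"
    moreover have "set us \<subseteq> set (x # xs)"
      using mset_eq_setD[OF Cons.prems(1)] ys by auto
    ultimately show "f x ** A = A ** f x"
      using Cons.prems(2) by auto
  qed
  ultimately show ?case
    by (simp add: ys matrix_mul_assoc)
qed

lemma unitary_op_prod:
  assumes "\<And>A. A \<in> set As \<Longrightarrow> unitary_op A"
  shows "unitary_op (op_prod As)"
  using assms
proof (induction As)
  case Nil
  then show ?case by (simp add: unitary_op_def)
qed (simp add: unitary_op_mult)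

lemma conj_op_prod:
  assumes "unitary_op U"
  shows "op_prod (map (\<lambda>m. U ** f m ** U\<^sup>\<dagger>) ms) = U ** op_prod (map f ms) ** U\<^sup>\<dagger>"
proof (induction ms)
  case Nil
  then show ?case using assms by (simp add: unitary_op_def)
next
  case (Cons m ms)
  then show ?case
    using unitary_conj_mult[OF unitary_op_hconj[OF assms]] by simp
qed

section \<open>The exponential of a rescaled projection\<close>

text \<open>Here \<open>h = 2 P\<close> with a projection \<open>P\<close>, so the exponential is
  exp(i pi P) = 1 + (exp(i pi) - 1) P = 1 - 2 P.\<close>

lemma op_exp_double_projection:
  fixes h :: "('h::finite) op"
  assumes "h ** h = h + h"
  shows "op_exp (mat (\<i> * of_real (pi / 2)) ** h) = mat 1 - h"
proof -
  define P where "P = mat (1 / 2) ** h"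
  define A where "A = mat (\<i> * of_real (pi / 2)) ** h"
  have hP: "h = P + P"
    by (simp add: P_def mat_op_left vec_eq_iff)
  have PP: "P ** P = P"
  proof -
    have "P ** P = mat (1/2) ** (h ** mat (1/2)) ** h"
      by (simp add: P_def matrix_mul_assoc)
    also have "\<dots> = mat (1/2) ** (mat (1/2) ** (h ** h))"
      by (simp only: mat_central[of _ h, symmetric] matrix_mul_assoc)
    also have "\<dots> = P"
      unfolding assms by (simp add: P_def mat_op_left vec_eq_iff)
    finally show ?thesis .
  qed
  have A: "A = mat (\<i> * of_real pi) ** P"
    by (simp add: A_def P_def mat_op_left vec_eq_iff)
  have pow: "((**) A ^^ Suc k) (mat 1) = mat ((\<i> * of_real pi) ^ Suc k) ** P" for k
  proof (induction k)
    case 0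
    then show ?case by (simp add: A)
  next
    case (Suc k)
    have "((**) A ^^ Suc (Suc k)) (mat 1) = A ** (mat ((\<i> * of_real pi) ^ Suc k) ** P)"
      using Suc by simp
    also have "\<dots> = mat (\<i> * of_real pi) ** (P ** mat ((\<i> * of_real pi) ^ Suc k)) ** P"
      by (simp add: A matrix_mul_assoc)
    also have "\<dots> = (mat (\<i> * of_real pi) ** mat ((\<i> * of_real pi) ^ Suc k)) ** (P ** P)"
      by (simp only: mat_central[of _ P, symmetric] matrix_mul_assoc)
    finally show ?case by (simp add: PP mat_mult)
  qed
  \<comment> \<open>The series is the scalar one for exp(i pi) times \<open>P\<close>, except that
    its zeroth term is the identity instead of \<open>P\<close>; the summand
    \<open>mat 1 - P\<close> at \<open>k = 0\<close> corrects this.\<close>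
  have term_eq: "(1 / fact k) *\<^sub>R ((**) A ^^ k) (mat 1)
      = mat ((\<i> * of_real pi) ^ k /\<^sub>R fact k) ** P + (if k = 0 then mat 1 - P else 0)" for k
  proof (cases k)
    case (Suc j)
    then show ?thesis
      by (simp only: pow) (simp add: mat_op_left vec_eq_iff divide_inverse scaleR_conv_of_real[where 'a = complex])
  qed simp
  \<comment> \<open>In finite dimension this linear map is bounded, so it carries the convergent
    scalar series over to operators.\<close>
  have "linear (\<lambda>z. mat z ** P)"
    by (rule linearI)
      (simp_all add: mat_op_left vec_eq_iff algebra_simps scaleR_conv_of_real[where 'a = complex])
  then have bl: "bounded_linear (\<lambda>z. mat z ** P)"
    by (simp add: linear_conv_bounded_linear)
  have "(\<lambda>k. mat ((\<i> * of_real pi) ^ k /\<^sub>R fact k) ** P) sums (mat (exp (\<i> * of_real pi)) ** P)"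
    by (rule bounded_linear.sums[OF bl exp_converges])
  moreover have "(\<lambda>k::nat. if k = 0 then mat 1 - P else 0) sums (mat 1 - P)"
    by (rule sums_single)
  ultimately have "(\<lambda>k. (1 / fact k) *\<^sub>R ((**) A ^^ k) (mat 1))
      sums (mat (exp (\<i> * of_real pi)) ** P + (mat 1 - P))"
    unfolding term_eq by (rule sums_add)
  then have "op_exp A = mat (- 1) ** P + (mat 1 - P)"
    unfolding op_exp_def using sums_unique by (simp add: exp_pi_i' sums_iff)
  then show ?thesis
    by (simp add: A_def mat_minus_one hP)
qed

section \<open>Parity grading\<close>

text \<open>The Boolean records the parity of the number of generators in a product.\<close>

inductive graded :: "('h::finite) op set \<Rightarrow> bool \<Rightarrow> 'h op \<Rightarrow> bool" for G where
  graded_scalar: "graded G False (mat z)"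
| graded_zero: "graded G p 0"
| graded_gen: "g \<in> G \<Longrightarrow> graded G True g"
| graded_add: "graded G p X \<Longrightarrow> graded G p Y \<Longrightarrow> graded G p (X + Y)"
| graded_mult: "graded G p X \<Longrightarrow> graded G q Y \<Longrightarrow> graded G (p \<noteq> q) (X ** Y)"

definition par :: "bool \<Rightarrow> ('h::finite) op \<Rightarrow> 'h op" where
  "par p X = (if p then - X else X)"

lemma graded_uminus: "graded G p X \<Longrightarrow> graded G p (- X)"
  using graded_mult[OF graded_scalar[of G "- 1"], of p X] by (simp add: mat_minus_one)

lemma graded_par: "graded G p X \<Longrightarrow> graded G p (par q X)"
  by (simp add: par_def graded_uminus)

lemma graded_scale: "graded G p X \<Longrightarrow> graded G p (mat z ** X)"
  using graded_mult[OF graded_scalar[of G z], of p X] by simp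

lemma graded_mult_same: "graded G p X \<Longrightarrow> graded G p Y \<Longrightarrow> graded G False (X ** Y)"
  using graded_mult[of G p X p Y] by simp

text \<open>Every generator that \<open>w\<close> passes contributes one minus sign, so only the
  parity of their number matters.\<close>

lemma graded_commute:
  assumes "graded G p X" and "\<And>g. g \<in> G \<Longrightarrow> acomm w g = 0"
  shows "w ** X = par p (X ** w)"
  using assms(1)
proof induction
  case (graded_mult p X q Y)
  have "w ** (X ** Y) = par p (X ** w) ** Y"
    using graded_mult by (simp add: matrix_mul_assoc)
  also have "\<dots> = par p (X ** (w ** Y))"
    by (simp add: par_def op_minus_left matrix_mul_assoc)
  also have "\<dots> = par (p \<noteq> q) (X ** Y ** w)"
    using graded_mult by (simp add: par_def op_minus_right matrix_mul_assoc)
  finally show ?case .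
qed (use assms(2) in \<open>auto simp: par_def mat_central op_distribs acomm_eq_0_iff\<close>)

lemma graded_even_commute:
  assumes "graded G False X" and "\<And>g. g \<in> G \<Longrightarrow> acomm w g = 0"
  shows "w ** X = X ** w"
  using graded_commute[OF assms] by (simp add: par_def)

text \<open>A normal form: all factors \<open>w\<close> are moved to the right at the price of
  signs, and as \<open>w ** w\<close> is a scalar, at most one survives. Its coefficient has the
  opposite parity because \<open>w\<close> itself is odd.\<close>

lemma graded_insert_decompose:
  assumes "graded (insert w G) p X" and "w ** w = mat s"
    and anti: "\<And>g. g \<in> G \<Longrightarrow> acomm w g = 0"
  shows "\<exists>A B. graded G p A \<and> graded G (\<not> p) B \<and> X = A + B ** w"
  using assms(1)
proof induction
  case (graded_scalar z)
  show ?case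
    by (rule exI[of _ "mat z"], rule exI[of _ 0]) (simp add: graded.intros)
next
  case (graded_zero p)
  show ?case
    by (rule exI[of _ 0], rule exI[of _ 0]) (simp add: graded.intros)
next
  case (graded_gen g)
  show ?case
  proof (cases "g = w")
    case True
    then show ?thesis
      by (intro exI[of _ 0] exI[of _ "mat 1"]) (simp add: graded.intros)
  next
    case False
    then show ?thesis
      using graded_gen by (intro exI[of _ g] exI[of _ 0]) (simp add: graded.intros)
  qed
next
  case (graded_add p X Y)
  then obtain A B A' B' where "graded G p A" "graded G (\<not> p) B" "X = A + B ** w"
      "graded G p A'" "graded G (\<not> p) B'" "Y = A' + B' ** w"
    by blast
  then show ?case
    by (intro exI[of _ "A + A'"] exI[of _ "B + B'"]) (simp add: graded.graded_add op_distribs)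
next
  case (graded_mult p X q Y)
  then obtain A B A' B' where
    X: "graded G p A" "graded G (\<not> p) B" "X = A + B ** w" and
    Y: "graded G q A'" "graded G (\<not> q) B'" "Y = A' + B' ** w"
    by blast
  have w: "w ** A' = par q (A' ** w)" "w ** B' = par (\<not> q) (B' ** w)"
    using graded_commute Y(1,2) anti by blast+
  have 1: "B ** w ** A' = par q (B ** A') ** w"
  proof -
    have "B ** w ** A' = B ** (w ** A')"
      by (simp add: matrix_mul_assoc)
    then show ?thesis
      by (simp add: w par_def op_minus_left op_minus_right matrix_mul_assoc)
  qed
  \<comment> \<open>Two factors \<open>w\<close> meet and become the scalar \<open>s\<close>, so
    this term joins the part free of \<open>w\<close>.\<close>
  have 2: "B ** w ** B' ** w = mat s ** par (\<not> q) (B ** B')"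
  proof -
    have "B ** w ** B' ** w = B ** (w ** B') ** w"
      by (simp add: matrix_mul_assoc)
    also have "\<dots> = par (\<not> q) (B ** B' ** (w ** w))"
      by (simp add: w par_def op_minus_left op_minus_right matrix_mul_assoc)
    also have "\<dots> = mat s ** par (\<not> q) (B ** B')"
      unfolding assms(2) by (simp add: par_def op_minus_right op_minus_left mat_central)
    finally show ?thesis .
  qed
  have "X ** Y = (A ** A' + mat s ** par (\<not> q) (B ** B'))
      + (A ** B' + par q (B ** A')) ** w"
    unfolding X(3) Y(3) by (simp add: op_distribs 1 2 matrix_mul_assoc)
  moreover have "graded G (p \<noteq> q) (A ** A' + mat s ** par (\<not> q) (B ** B'))"
    using graded.graded_mult[OF X(1) Y(1)] graded.graded_mult[OF X(2) Y(2)]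
    by (intro graded.graded_add graded_scale graded_par) auto
  moreover have "graded G (\<not> (p \<noteq> q)) (A ** B' + par q (B ** A'))"
    using graded.graded_mult[OF X(1) Y(2)] graded.graded_mult[OF X(2) Y(1)]
    by (intro graded.graded_add graded_par) auto
  ultimately show ?case by blast
qed

text \<open>In the normal form the even \<open>A\<close> commutes with \<open>w\<close> and the odd
  \<open>B\<close> anticommutes with it. Comparing \<open>w ** X\<close> with \<open>X ** w\<close>
  gives \<open>2 s B = 0\<close>, hence \<open>B = 0\<close>.\<close>

lemma graded_remove_generator:
  assumes "graded (insert w G) False X" and ww: "w ** w = mat s" and "s \<noteq> 0"
    and anti: "\<And>g. g \<in> G \<Longrightarrow> acomm w g = 0" and comm: "w ** X = X ** w"
  shows "graded G False X"
proof -
  obtain A B where A: "graded G False A" and B: "graded G True B" and X: "X = A + B ** w"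
    using graded_insert_decompose[OF assms(1) ww anti] by auto
  have wA: "w ** A = A ** w"
    using graded_even_commute[OF A anti] .
  have wB: "w ** B = - (B ** w)"
    using graded_commute[OF B anti] by (simp add: par_def)
  have "w ** (B ** w) = B ** w ** w"
    using comm wA by (simp add: X op_distribs)
  then have "- (B ** (w ** w)) = B ** (w ** w)"
    by (simp add: matrix_mul_assoc wB op_minus_left)
  then have "B ** mat s + B ** mat s = 0"
    unfolding ww by (simp only: neg_eq_iff_add_eq_0)
  then have "B ** mat s = 0"
    by (rule op_double_eq_0_iff[THEN iffD1])
  then have "B = 0"
    using \<open>s \<noteq> 0\<close> by (simp add: mat_op_right vec_eq_iff)
  then show ?thesis
    using A X by simp
qed

lemma graded_remove_generators:
  assumes "finite J" and "graded (w ` (I \<union> J)) False X" and "I \<inter> J = {}"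
    and sq: "\<And>j. j \<in> J \<Longrightarrow> \<exists>s. s \<noteq> 0 \<and> w j ** w j = mat s"
    and anti: "\<And>i j. i \<in> I \<union> J \<Longrightarrow> j \<in> J \<Longrightarrow> i \<noteq> j \<Longrightarrow> acomm (w j) (w i) = 0"
    and comm: "\<And>j. j \<in> J \<Longrightarrow> w j ** X = X ** w j"
  shows "graded (w ` I) False X"
  using assms
proof (induction J rule: finite_induct)
  case empty
  then show ?case by simp
next
  case (insert j J)
  obtain s where s: "s \<noteq> 0" "w j ** w j = mat s"
    using insert.prems(3) by blast
  have "graded (w ` (I \<union> J)) False X"
  proof (rule graded_remove_generator[OF _ s(2,1)])
    show "graded (insert (w j) (w ` (I \<union> J))) False X"
      using insert.prems(1) by simp
    show "acomm (w j) g = 0" if "g \<in> w ` (I \<union> J)" for g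
      using that insert.prems(2) insert.hyps(2) by (auto intro!: insert.prems(4))
  qed (use insert.prems(5) in blast)
  then show ?case
    using insert.prems by (intro insert.IH) auto
qed

section \<open>Majorana operators\<close>

text \<open>The second operator is left anti-Hermitian, which keeps \<open>\<i>\<close> out of the formulas; it
  squares to \<open>-1\<close>.\<close>

definition majorana :: "('m \<Rightarrow> ('h::finite) op) \<Rightarrow> 'm \<times> bool \<Rightarrow> 'h op" where
  "majorana f = (\<lambda>(i, s). if s then f i - (f i)\<^sup>\<dagger> else f i + (f i)\<^sup>\<dagger>)"

lemma CAR_acomm:
  assumes "CAR M f" "i \<in> M" "j \<in> M"
  shows "acomm (f i) (f j) = 0" "acomm (f i)\<^sup>\<dagger> (f j)\<^sup>\<dagger> = 0"
    "acomm (f i) (f j)\<^sup>\<dagger> = (if i = j then mat 1 else 0)"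
    "acomm (f i)\<^sup>\<dagger> (f j) = (if i = j then mat 1 else 0)"
  using assms acomm_commute[of "(f i)\<^sup>\<dagger>" "f j"] unfolding CAR_def by auto

text \<open>In the expanded square \<open>f i\<close> and its adjoint square to zero, and the mixed
  terms form plus or minus their anticommutator. A nonzero scalar is what the removal of a generator
  requires.\<close>

lemma majorana_square:
  assumes "CAR M f" "i \<in> M"
  shows "\<exists>s. s \<noteq> 0 \<and> majorana f (i, p) ** majorana f (i, p) = mat s"
proof -
  note r = CAR_acomm[OF assms(1,2,2)]
  have "f i ** f i = 0" "(f i)\<^sup>\<dagger> ** (f i)\<^sup>\<dagger> = 0"
    using r(1,2) unfolding acomm_def op_double_eq_0_iff by auto
  moreover have "f i ** (f i)\<^sup>\<dagger> + (f i)\<^sup>\<dagger> ** f i = mat 1"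
    using r(3) by (simp add: acomm_def)
  ultimately have "(f i + (f i)\<^sup>\<dagger>) ** (f i + (f i)\<^sup>\<dagger>) = mat 1"
    "(f i - (f i)\<^sup>\<dagger>) ** (f i - (f i)\<^sup>\<dagger>) = - mat 1"
    by (simp_all add: op_distribs algebra_simps)
  moreover have "- mat 1 = (mat (- 1) :: 'b op)"
    using mat_minus_one[of "mat 1 :: 'b op"] by simp
  ultimately show ?thesis
    by (intro exI[of _ "if p then - 1 else 1"]) (simp add: majorana_def)
qed

text \<open>For the two operators of one mode, the anticommutator of the mode with its adjoint
  enters twice with opposite signs; for different modes every term vanishes.\<close>

lemma majorana_acomm:
  assumes "CAR M f" "fst x \<in> M" "fst y \<in> M" "x \<noteq> y"
  shows "acomm (majorana f x) (majorana f y) = 0"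
  using assms(2-4) CAR_acomm[OF assms(1)]
  by (cases x; cases y) (auto simp: majorana_def acomm_linear)

lemma majorana_anticommute_modes:
  assumes "acomm w (f i) = 0" "acomm w (f i)\<^sup>\<dagger> = 0"
  shows "acomm w (majorana f (i, p)) = 0"
  using assms by (simp add: majorana_def acomm_linear)

lemma ann_majorana:
  "f i = mat (1 / 2) ** (majorana f (i, False) + majorana f (i, True))"
  by (simp add: majorana_def mat_op_left vec_eq_iff)

lemma cre_majorana:
  "(f i)\<^sup>\<dagger> = mat (1 / 2) ** (majorana f (i, False) + - majorana f (i, True))"
  by (simp add: majorana_def mat_op_left vec_eq_iff)

text \<open>Expressions may mix parities, so both parts are carried through the induction. In a
  product the even part collects even-even and odd-odd, the odd part the two mixed terms.\<close>

lemma eval_expr_parity: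
  assumes "set_expr e \<subseteq> M"
  shows "\<exists>X Y. graded (majorana f ` (M \<times> UNIV)) False X \<and>
    graded (majorana f ` (M \<times> UNIV)) True Y \<and> eval_expr f e = X + Y"
  using assms
proof (induction e)
  case (Scalar z)
  show ?case
    by (rule exI[of _ "mat z"], rule exI[of _ 0]) (simp add: graded.intros)
next
  case (Ann i)
  then have "graded (majorana f ` (M \<times> UNIV)) True (f i)"
    by (subst ann_majorana[of f i], intro graded_scale graded_add) (auto intro: graded_gen)
  then show ?case
    by (intro exI[of _ 0] exI[of _ "f i"]) (simp add: graded_zero)
next
  case (Cre i)
  then have "graded (majorana f ` (M \<times> UNIV)) True (f i)\<^sup>\<dagger>"
    by (subst cre_majorana[of f i], intro graded_scale graded_add graded_uminus)
      (auto intro: graded_gen)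
  then show ?case
    by (intro exI[of _ 0] exI[of _ "(f i)\<^sup>\<dagger>"]) (simp add: graded_zero)
next
  case (Add e e')
  let ?G = "majorana f ` (M \<times> UNIV)"
  obtain X Y X' Y' where "graded ?G False X" "graded ?G True Y" "eval_expr f e = X + Y"
      "graded ?G False X'" "graded ?G True Y'" "eval_expr f e' = X' + Y'"
    using Add by auto
  then show ?case
    by (intro exI[of _ "X + X'"] exI[of _ "Y + Y'"]) (auto intro: graded_add)
next
  case (Mul e e')
  let ?G = "majorana f ` (M \<times> UNIV)"
  obtain X Y X' Y' where *: "graded ?G False X" "graded ?G True Y" "eval_expr f e = X + Y"
      "graded ?G False X'" "graded ?G True Y'" "eval_expr f e' = X' + Y'"
    using Mul by auto
  show ?case
  proof (intro exI conjI)
    show "graded ?G False (X ** X' + Y ** Y')"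
      using * by (blast intro: graded_add graded_mult_same)
    show "graded ?G True (X ** Y' + Y ** X')"
      using graded_mult[OF *(1,5)] graded_mult[OF *(2,4)] by (simp add: graded_add)
  qed (simp add: * op_distribs)
qed

text \<open>An odd operator that commutes with both \<open>c\<close> and \<open>c\<^sup>\<dagger>\<close> is killed by them, hence by
  \<open>c c\<^sup>\<dagger> + c\<^sup>\<dagger> c = 1\<close>.\<close>

lemma eval_expr_even:
  assumes "set_expr e \<subseteq> M" and cc: "acomm c c\<^sup>\<dagger> = mat 1"
    and c: "\<And>i. i \<in> M \<Longrightarrow> acomm c (f i) = 0" "\<And>i. i \<in> M \<Longrightarrow> acomm c (f i)\<^sup>\<dagger> = 0"
    and comm: "c ** eval_expr f e = eval_expr f e ** c"
      "c\<^sup>\<dagger> ** eval_expr f e = eval_expr f e ** c\<^sup>\<dagger>"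
  shows "graded (majorana f ` (M \<times> UNIV)) False (eval_expr f e)"
proof -
  let ?G = "majorana f ` (M \<times> UNIV)"
  obtain X Y where X: "graded ?G False X" and Y: "graded ?G True Y" and e: "eval_expr f e = X + Y"
    using eval_expr_parity[OF assms(1)] by blast
  have "Y ** w = 0" if w: "w = c \<or> w = c\<^sup>\<dagger>" for w
  proof -
    have "acomm w (f i) = 0 \<and> acomm w (f i)\<^sup>\<dagger> = 0" if "i \<in> M" for i
      using w c[OF that] hconj_acomm[of c "f i"] hconj_acomm[of c "(f i)\<^sup>\<dagger>"] by auto
    then have anti: "acomm w g = 0" if "g \<in> ?G" for g
      using that by (auto intro: majorana_anticommute_modes)
    have "w ** X = X ** w" "w ** Y = - (Y ** w)"
      using graded_even_commute[OF X anti] graded_commute[OF Y anti] by (auto simp: par_def)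
    moreover have "w ** (X + Y) = (X + Y) ** w"
      using comm w e by auto
    \<comment> \<open>Cancelling the even part leaves \<open>w ** Y = Y ** w\<close>, while oddness
      gives the opposite sign.\<close>
    ultimately have "Y ** w + Y ** w = 0"
      by (metis add_left_cancel add.right_inverse matrix_add_ldistrib op_add_rdistrib)
    then show ?thesis
      by (rule op_double_eq_0_iff[THEN iffD1])
  qed
  then have "Y ** (c ** c\<^sup>\<dagger> + c\<^sup>\<dagger> ** c) = 0"
    by (simp add: op_distribs matrix_mul_assoc)
  then have "Y = 0"
    using cc by (simp add: acomm_def)
  then show ?thesis
    using X e by simp
qed

text \<open>Leads back from the graded algebra to formal expressions, in terms of which localization
  is defined. Subtraction and the zero operator are expressed through the scalars -1 and 0.\<close>

lemma graded_majorana_expr: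
  assumes "graded (majorana f ` (M \<times> UNIV)) p X"
  shows "\<exists>e. set_expr e \<subseteq> M \<and> X = eval_expr f e"
  using assms
proof induction
  case (graded_scalar z)
  then show ?case by (intro exI[of _ "Scalar z"]) simp
next
  case (graded_zero p)
  then show ?case by (intro exI[of _ "Scalar 0"]) (simp add: mat_def vec_eq_iff)
next
  case (graded_gen g)
  then obtain i s where i: "i \<in> M" and g: "g = majorana f (i, s)"
    by auto
  show ?case
  proof (cases s)
    case True
    then show ?thesis
      using i g by (intro exI[of _ "Add (Ann i) (Mul (Scalar (- 1)) (Cre i))"])
        (simp add: majorana_def mat_minus_one)
  next
    case False
    then show ?thesis
      using i g by (intro exI[of _ "Add (Ann i) (Cre i)"]) (simp add: majorana_def)
  qed
next
  case (graded_add p X Y)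
  then obtain e e' where "set_expr e \<subseteq> M" "X = eval_expr f e" "set_expr e' \<subseteq> M" "Y = eval_expr f e'"
    by blast
  then show ?case by (intro exI[of _ "Add e e'"]) simp
next
  case (graded_mult p X q Y)
  then obtain e e' where "set_expr e \<subseteq> M" "X = eval_expr f e" "set_expr e' \<subseteq> M" "Y = eval_expr f e'"
    by blast
  then show ?case by (intro exI[of _ "Mul e e'"]) simp
qed

section \<open>Expressions and localized operators\<close>

lemma eval_expr_commute:
  assumes "\<And>i. i \<in> set_expr e \<Longrightarrow> X ** f i = f i ** X"
    and "\<And>i. i \<in> set_expr e \<Longrightarrow> X ** (f i)\<^sup>\<dagger> = (f i)\<^sup>\<dagger> ** X"
  shows "X ** eval_expr f e = eval_expr f e ** X"
  using assms by (induction e) (auto simp: mat_central op_distribs intro: commute_mult)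

text \<open>Conjugation by a unitary respects scalars, sums, products and adjoints, so it is
  determined by its effect on the modes.\<close>

lemma eval_expr_conj:
  assumes "unitary_op U" and "\<And>i. i \<in> set_expr e \<Longrightarrow> U\<^sup>\<dagger> ** f i ** U = g i"
  shows "U\<^sup>\<dagger> ** eval_expr f e ** U = eval_expr g e"
  using assms(2)
proof (induction e)
  case (Scalar z)
  show ?case
    using assms(1) by (metis eval_expr.simps(1) mat_central unitary_conj_eq_iff)
next
  case (Cre i)
  then show ?case
    using hconj_conj[of U "f i"] by simp
next
  case (Mul e e')
  then show ?case
    by (simp add: unitary_conj_mult[OF assms(1)])
qed (simp_all add: op_distribs)

primrec adj_expr :: "'m expr \<Rightarrow> 'm expr" where
  "adj_expr (Scalar z) = Scalar (cnj z)"
| "adj_expr (Ann i) = Cre i"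
| "adj_expr (Cre i) = Ann i"
| "adj_expr (Add e e') = Add (adj_expr e) (adj_expr e')"
| "adj_expr (Mul e e') = Mul (adj_expr e') (adj_expr e)"

lemma set_adj_expr [simp]: "set_expr (adj_expr e) = set_expr e"
  by (induction e) auto

lemma eval_adj_expr: "eval_expr f (adj_expr e) = (eval_expr f e)\<^sup>\<dagger>"
  by (induction e) auto

lemma localized_hconj: "localized a b R X \<Longrightarrow> localized a b R X\<^sup>\<dagger>"
  unfolding localized_def by (metis eval_adj_expr set_adj_expr)

lemma localized_mult:
  assumes "localized a b R X" "localized a b R Y"
  shows "localized a b R (X ** Y)"
proof -
  obtain e e' where "set_expr e \<subseteq> R <+> R" "X = eval_expr (case_sum a b) e"
      "set_expr e' \<subseteq> R <+> R" "Y = eval_expr (case_sum a b) e'"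
    using assms unfolding localized_def by blast
  then show ?thesis
    unfolding localized_def by (intro exI[of _ "Mul e e'"]) simp
qed

lemma localized_mono: "localized a b R X \<Longrightarrow> R \<subseteq> R' \<Longrightarrow> localized a b R' X"
  unfolding localized_def by blast

lemma eval_expr_map: "eval_expr f (map_expr h e) = eval_expr (f \<circ> h) e"
  by (induction e) auto

lemma localized_second_copy:
  assumes "set_expr e \<subseteq> R"
  shows "localized a b R (eval_expr b e)"
  unfolding localized_def
  by (rule exI[of _ "map_expr Inr e"]) (use assms in \<open>auto simp: expr.set_map eval_expr_map comp_def\<close>)

lemma localized_commute:
  assumes "localized a b R Y"
    and "\<And>k. k \<in> R \<Longrightarrow> X ** a k = a k ** X" "\<And>k. k \<in> R \<Longrightarrow> X ** (a k)\<^sup>\<dagger> = (a k)\<^sup>\<dagger> ** X"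
    and "\<And>k. k \<in> R \<Longrightarrow> X ** b k = b k ** X" "\<And>k. k \<in> R \<Longrightarrow> X ** (b k)\<^sup>\<dagger> = (b k)\<^sup>\<dagger> ** X"
  shows "X ** Y = Y ** X"
  using assms unfolding localized_def by (auto intro!: eval_expr_commute)

lemma localized_even:
  assumes "localized a b \<Lambda> X" and anc: "ancilla \<Lambda> a b c"
    and comm: "c ** X = X ** c" "c\<^sup>\<dagger> ** X = X ** c\<^sup>\<dagger>"
  shows "graded (majorana (case_sum a b) ` ((\<Lambda> <+> \<Lambda>) \<times> UNIV)) False X"
proof -
  obtain e where e: "set_expr e \<subseteq> \<Lambda> <+> \<Lambda>" "X = eval_expr (case_sum a b) e"
    using assms(1) unfolding localized_def by blast
  show ?thesis
    unfolding e(2) using anc comm e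
    by (intro eval_expr_even[where c = c]) (auto simp: ancilla_def)
qed

text \<open>The Majorana operators outside \<open>R\<close> are removed one after the other: in \<open>X = A + B w\<close>
  with \<open>A\<close> even and \<open>B\<close> odd, \<open>w\<close> commutes with \<open>A\<close> and anticommutes with \<open>B w\<close>.\<close>

lemma even_localized_commutant:
  assumes "finite \<Lambda>" "two_copies \<Lambda> a b" "ancilla \<Lambda> a b c" "R \<subseteq> \<Lambda>" "localized a b \<Lambda> X"
    and c: "c ** X = X ** c" "c\<^sup>\<dagger> ** X = X ** c\<^sup>\<dagger>"
    and "\<And>k. k \<in> \<Lambda> - R \<Longrightarrow> X ** a k = a k ** X"
    and "\<And>k. k \<in> \<Lambda> - R \<Longrightarrow> X ** (a k)\<^sup>\<dagger> = (a k)\<^sup>\<dagger> ** X"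
    and "\<And>k. k \<in> \<Lambda> - R \<Longrightarrow> X ** b k = b k ** X"
    and "\<And>k. k \<in> \<Lambda> - R \<Longrightarrow> X ** (b k)\<^sup>\<dagger> = (b k)\<^sup>\<dagger> ** X"
  shows "localized a b R X"
proof -
  define f where "f = case_sum a b"
  define I where "I = (R <+> R) \<times> (UNIV :: bool set)"
  define J where "J = ((\<Lambda> - R) <+> (\<Lambda> - R)) \<times> (UNIV :: bool set)"
  have CAR: "CAR (\<Lambda> <+> \<Lambda>) f"
    using assms(2) by (simp add: two_copies_def f_def)
  have IJ: "I \<union> J = (\<Lambda> <+> \<Lambda>) \<times> UNIV"
    using assms(4) by (auto simp: I_def J_def)
  have "graded (majorana f ` I) False X"
  proof (rule graded_remove_generators)
    show "finite J"
      using assms(1) by (simp add: J_def)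
    show "graded (majorana f ` (I \<union> J)) False X"
      unfolding IJ f_def by (rule localized_even[OF assms(5,3) c])
    show "I \<inter> J = {}"
      by (auto simp: I_def J_def)
    show "\<exists>s. s \<noteq> 0 \<and> majorana f j ** majorana f j = mat s" if "j \<in> J" for j
    proof -
      have "fst j \<in> \<Lambda> <+> \<Lambda>"
        using that by (auto simp: J_def)
      then show ?thesis
        using majorana_square[OF CAR, of "fst j" "snd j"] by simp
    qed
    show "acomm (majorana f j) (majorana f i) = 0" if "i \<in> I \<union> J" "j \<in> J" "i \<noteq> j" for i j
    proof (rule majorana_acomm[OF CAR])
      have "i \<in> I \<union> J" "j \<in> I \<union> J"
        using that by auto
      then show "fst j \<in> \<Lambda> <+> \<Lambda>" "fst i \<in> \<Lambda> <+> \<Lambda>"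
        unfolding IJ by auto
    qed (use that in simp)
    show "majorana f j ** X = X ** majorana f j" if "j \<in> J" for j
      using that assms(8-11) by (auto simp: J_def majorana_def f_def op_distribs)
  qed
  then show ?thesis
    unfolding I_def f_def localized_def by (rule graded_majorana_expr)
qed

section \<open>The on-site swap\<close>

locale two_copies_ancilla =
  fixes \<Lambda> :: "'s set" and a b :: "'s \<Rightarrow> ('h::finite) op" and c :: "'h op"
  assumes copies: "two_copies \<Lambda> a b" and anc: "ancilla \<Lambda> a b c"
begin

abbreviation "S \<equiv> site_swap a b"

lemma acomm_modes:
  assumes "i \<in> \<Lambda>" "j \<in> \<Lambda>"
  shows "acomm (a i) (a j) = 0" "acomm (a i)\<^sup>\<dagger> (a j)\<^sup>\<dagger> = 0"
    "acomm (b i) (b j) = 0" "acomm (b i)\<^sup>\<dagger> (b j)\<^sup>\<dagger> = 0"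
    "acomm (a i) (b j) = 0" "acomm (a i)\<^sup>\<dagger> (b j)\<^sup>\<dagger> = 0"
    "acomm (b i) (a j) = 0" "acomm (b i)\<^sup>\<dagger> (a j)\<^sup>\<dagger> = 0"
    "acomm (a i) (b j)\<^sup>\<dagger> = 0" "acomm (a i)\<^sup>\<dagger> (b j) = 0"
    "acomm (b i) (a j)\<^sup>\<dagger> = 0" "acomm (b i)\<^sup>\<dagger> (a j) = 0"
    "acomm (a i) (a j)\<^sup>\<dagger> = (if i = j then mat 1 else 0)"
    "acomm (a i)\<^sup>\<dagger> (a j) = (if i = j then mat 1 else 0)"
    "acomm (b i) (b j)\<^sup>\<dagger> = (if i = j then mat 1 else 0)"
    "acomm (b i)\<^sup>\<dagger> (b j) = (if i = j then mat 1 else 0)"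
proof -
  note CAR = copies[unfolded two_copies_def]
  have m: "Inl i \<in> \<Lambda> <+> \<Lambda>" "Inr i \<in> \<Lambda> <+> \<Lambda>" "Inl j \<in> \<Lambda> <+> \<Lambda>" "Inr j \<in> \<Lambda> <+> \<Lambda>"
    using assms by auto
  show "acomm (a i) (a j) = 0" "acomm (a i)\<^sup>\<dagger> (a j)\<^sup>\<dagger> = 0"
    "acomm (b i) (b j) = 0" "acomm (b i)\<^sup>\<dagger> (b j)\<^sup>\<dagger> = 0"
    "acomm (a i) (b j) = 0" "acomm (a i)\<^sup>\<dagger> (b j)\<^sup>\<dagger> = 0"
    "acomm (b i) (a j) = 0" "acomm (b i)\<^sup>\<dagger> (a j)\<^sup>\<dagger> = 0"
    "acomm (a i) (b j)\<^sup>\<dagger> = 0" "acomm (a i)\<^sup>\<dagger> (b j) = 0"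
    "acomm (b i) (a j)\<^sup>\<dagger> = 0" "acomm (b i)\<^sup>\<dagger> (a j) = 0"
    "acomm (a i) (a j)\<^sup>\<dagger> = (if i = j then mat 1 else 0)"
    "acomm (a i)\<^sup>\<dagger> (a j) = (if i = j then mat 1 else 0)"
    "acomm (b i) (b j)\<^sup>\<dagger> = (if i = j then mat 1 else 0)"
    "acomm (b i)\<^sup>\<dagger> (b j) = (if i = j then mat 1 else 0)"
    using CAR_acomm[OF CAR m(1) m(3)] CAR_acomm[OF CAR m(1) m(4)]
      CAR_acomm[OF CAR m(2) m(3)] CAR_acomm[OF CAR m(2) m(4)] by simp_all
qed

abbreviation difference :: "'s \<Rightarrow> 'h op" where "difference n \<equiv> b n - a n"

lemma difference_square:
  assumes "n \<in> \<Lambda>"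
  shows "difference n ** difference n = 0"
proof -
  have "acomm (difference n) (difference n) = 0"
    by (simp add: acomm_linear acomm_modes assms)
  then show ?thesis
    unfolding acomm_def by (rule op_double_eq_0_iff[THEN iffD1])
qed

text \<open>Because \<open>D ** D = 0\<close>, the product equals the anticommutator of
  \<open>D\<close> and \<open>D\<^sup>\<dagger>\<close> times \<open>D\<close>. That anticommutator
  is 2, one from each copy.\<close>

lemma difference_hconj_difference:
  assumes "n \<in> \<Lambda>"
  shows "difference n ** (difference n)\<^sup>\<dagger> ** difference n = difference n + difference n"
proof -
  let ?D = "difference n"
  have "acomm ?D ?D\<^sup>\<dagger> = mat 1 + mat 1"
    by (simp add: acomm_linear acomm_modes assms)
  then have *: "?D ** ?D\<^sup>\<dagger> + ?D\<^sup>\<dagger> ** ?D = mat 1 + mat 1"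
    by (simp only: acomm_def)
  have "?D ** ?D\<^sup>\<dagger> ** ?D = (?D ** ?D\<^sup>\<dagger> + ?D\<^sup>\<dagger> ** ?D) ** ?D"
    by (simp only: op_add_rdistrib matrix_mul_assoc[symmetric] difference_square[OF assms]
        op_zero_right add_0_right)
  then show ?thesis
    by (simp only: * op_add_rdistrib matrix_mul_lid)
qed

lemma site_swap_eq:
  assumes "n \<in> \<Lambda>"
  shows "S n = mat 1 - (difference n)\<^sup>\<dagger> ** difference n"
proof -
  let ?D = "difference n"
  have "(?D\<^sup>\<dagger> ** ?D) ** (?D\<^sup>\<dagger> ** ?D) = ?D\<^sup>\<dagger> ** (?D ** ?D\<^sup>\<dagger> ** ?D)"
    by (simp only: matrix_mul_assoc)
  also have "\<dots> = ?D\<^sup>\<dagger> ** ?D + ?D\<^sup>\<dagger> ** ?D"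
    unfolding difference_hconj_difference[OF assms] by (rule matrix_add_ldistrib)
  finally show ?thesis
    using op_exp_double_projection[of "?D\<^sup>\<dagger> ** ?D"] by (simp add: site_swap_def)
qed

lemma site_swap_hconj: "n \<in> \<Lambda> \<Longrightarrow> (S n)\<^sup>\<dagger> = S n"
  by (simp only: site_swap_eq hconj_diff hconj_mat hconj_mult hconj_hconj complex_cnj_one)

text \<open>The first identity comes from \<open>D ** D = 0\<close>; the second subtracts
  \<open>D D\<^sup>\<dagger> D = 2 D\<close> from \<open>D\<close>. Together they say that
  conjugation by the swap negates \<open>D\<close>.\<close>

lemma site_swap_difference:
  assumes "n \<in> \<Lambda>"
  shows "S n ** difference n = difference n" "difference n ** S n = - difference n"
proof -
  let ?D = "difference n"
  have "S n ** ?D = ?D - ?D\<^sup>\<dagger> ** (?D ** ?D)"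
    unfolding site_swap_eq[OF assms] op_diff_rdistrib[of "mat 1"] by (simp only: matrix_mul_assoc matrix_mul_lid)
  then show "S n ** ?D = ?D"
    by (simp only: difference_square[OF assms] op_zero_right diff_zero)
  have "?D ** S n = ?D - ?D ** ?D\<^sup>\<dagger> ** ?D"
    unfolding site_swap_eq[OF assms] op_diff_ldistrib[of _ "mat 1"] by (simp only: matrix_mul_assoc matrix_mul_rid)
  then show "?D ** S n = - ?D"
    by (simp only: difference_hconj_difference[OF assms] diff_add_eq_diff_diff_swap diff_self diff_0)
qed

lemma site_swap_square:
  assumes "n \<in> \<Lambda>"
  shows "S n ** S n = mat 1"
proof -
  let ?D = "difference n"
  have "S n ** S n = S n - (?D\<^sup>\<dagger> ** (?D ** S n))"
    by (subst (1) site_swap_eq[OF assms]) (simp only: op_diff_rdistrib[of "mat 1"] matrix_mul_lid matrix_mul_assoc)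
  also have "\<dots> = S n + ?D\<^sup>\<dagger> ** ?D"
    by (simp only: site_swap_difference[OF assms] op_minus_right diff_minus_eq_add)
  also have "\<dots> = mat 1"
    by (simp only: site_swap_eq[OF assms] diff_add_cancel)
  finally show ?thesis .
qed

lemma site_swap_unitary: "n \<in> \<Lambda> \<Longrightarrow> unitary_op (S n)"
  by (simp add: unitary_op_def site_swap_hconj site_swap_square)

text \<open>Applies to the modes at other sites, to the ancilla and to \<open>a n + b n\<close>, all
  of which the swap therefore fixes.\<close>

lemma site_swap_commute_anticommuting:
  assumes "n \<in> \<Lambda>" "acomm X (difference n) = 0" "acomm X (difference n)\<^sup>\<dagger> = 0"
  shows "X ** S n = S n ** X"
  using acomm_0_mult_commute[OF assms(3,2)]
  by (simp only: site_swap_eq[OF assms(1)] op_diff_ldistrib[of _ "mat 1"]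
      op_diff_rdistrib[of "mat 1"] matrix_mul_lid matrix_mul_rid)

lemma site_swap_other_site:
  assumes "n \<in> \<Lambda>" "k \<in> \<Lambda>" "k \<noteq> n"
  shows "S n ** a k = a k ** S n" "S n ** (a k)\<^sup>\<dagger> = (a k)\<^sup>\<dagger> ** S n"
    "S n ** b k = b k ** S n" "S n ** (b k)\<^sup>\<dagger> = (b k)\<^sup>\<dagger> ** S n"
  using assms
  by (auto intro!: site_swap_commute_anticommuting[symmetric] simp: acomm_linear acomm_modes)

lemma site_swap_ancilla: "n \<in> \<Lambda> \<Longrightarrow> c ** S n = S n ** c"
  using anc by (intro site_swap_commute_anticommuting) (auto simp: ancilla_def acomm_linear)

lemma site_swap_fermionic: "n \<in> \<Lambda> \<Longrightarrow> fermionic c (S n)"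
  unfolding fermionic_def by (subst unitary_conj_eq_iff) (simp_all add: site_swap_unitary site_swap_ancilla)

text \<open>Write \<open>2 b\<close> as \<open>(a + b) + (b - a)\<close>. The swap commutes with the
  first summand and anticommutes with the second, so moving it to the right turns \<open>2 b\<close>
  into \<open>2 a\<close>.\<close>

lemma site_swap_exchange:
  assumes "n \<in> \<Lambda>"
  shows "S n ** b n = a n ** S n"
proof -
  let ?S = "S n"
  have 1: "?S ** (a n + b n) = (a n + b n) ** ?S"
    using assms by (intro site_swap_commute_anticommuting[symmetric]) (simp_all add: acomm_linear acomm_modes)
  have 2: "?S ** b n - ?S ** a n = b n - a n" "b n ** ?S - a n ** ?S = a n - b n"
    using site_swap_difference[OF assms] by (simp_all add: op_distribs)
  have "?S ** b n + ?S ** b n = (?S ** a n + ?S ** b n) + (?S ** b n - ?S ** a n)"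
    by simp
  also have "\<dots> = (a n ** ?S + b n ** ?S) - (b n ** ?S - a n ** ?S)"
    using 1 unfolding 2 by (simp add: op_distribs)
  finally have "?S ** b n + ?S ** b n = a n ** ?S + a n ** ?S"
    by simp
  then show ?thesis
    by (simp only: op_double_eq_iff)
qed

lemma site_swap_swaps_modes:
  assumes "n \<in> \<Lambda>"
  shows "swaps_modes_at \<Lambda> a b n (S n)"
proof -
  have "S n ** a n = b n ** S n"
    using site_swap_exchange[OF assms] site_swap_square[OF assms]
    by (metis matrix_mul_assoc matrix_mul_lid matrix_mul_rid)
  then show ?thesis
    using assms site_swap_exchange[OF assms] site_swap_other_site[OF assms]
    by (simp add: swaps_modes_at_def unitary_conj_eq_iff[OF site_swap_unitary])
qed

lemma site_swap_localized:
  assumes "n \<in> \<Lambda>"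
  shows "localized a b {n} (S n)"
proof -
  \<comment> \<open>The witness spells out the closed form \<open>1 - D\<^sup>\<dagger> D\<close>,
    since an infinite series is not an expression.\<close>
  let ?neg = "\<lambda>e. Mul (Scalar (- 1)) e"
  let ?e = "Add (Scalar 1) (?neg (Mul (Add (Cre (Inr n)) (?neg (Cre (Inl n))))
    (Add (Ann (Inr n)) (?neg (Ann (Inl n))))))"
  have "S n = eval_expr (case_sum a b) ?e"
    by (simp add: site_swap_eq[OF assms] mat_minus_one)
  moreover have "set_expr ?e \<subseteq> {n} <+> {n}"
    by auto
  ultimately show ?thesis
    unfolding localized_def by blast
qed

section \<open>Products of on-site swaps\<close>

lemma site_swap_commute:
  assumes "m \<in> \<Lambda>" "n \<in> \<Lambda>"
  shows "S m ** S n = S n ** S m"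
proof (cases "m = n")
  case False
  then show ?thesis
    using assms by (intro localized_commute[OF site_swap_localized]) (auto intro!: site_swap_other_site)
qed simp

text \<open>Distinctness matters: a second swap at a site would undo the first. Both claims are
  proved together because the swap at site \<open>k\<close> turns the claim for one copy into that
  for the other.\<close>

lemma swap_product_modes:
  assumes "distinct ns" "set ns \<subseteq> \<Lambda>" "k \<in> \<Lambda>"
  defines "T \<equiv> op_prod (map S ns)"
  shows "T\<^sup>\<dagger> ** a k ** T = (if k \<in> set ns then b k else a k)"
    and "T\<^sup>\<dagger> ** b k ** T = (if k \<in> set ns then a k else b k)"
proof -
  have "(op_prod (map S ns))\<^sup>\<dagger> ** a k ** op_prod (map S ns) = (if k \<in> set ns then b k else a k) \<and>
    (op_prod (map S ns))\<^sup>\<dagger> ** b k ** op_prod (map S ns) = (if k \<in> set ns then a k else b k)"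
    using assms(1,2)
  proof (induction ns)
    case (Cons n ns)
    let ?T = "op_prod (map S ns)"
    have conj: "(op_prod (map S (n # ns)))\<^sup>\<dagger> ** X ** op_prod (map S (n # ns))
        = ?T\<^sup>\<dagger> ** ((S n)\<^sup>\<dagger> ** X ** S n) ** ?T" for X
      by (simp add: matrix_mul_assoc)
    have "swaps_modes_at \<Lambda> a b n (S n)"
      using Cons.prems by (simp add: site_swap_swaps_modes)
    then show ?case
      unfolding conj using Cons assms(3) by (cases "k = n") (auto simp: swaps_modes_at_def)
  qed simp
  then show "T\<^sup>\<dagger> ** a k ** T = (if k \<in> set ns then b k else a k)"
    "T\<^sup>\<dagger> ** b k ** T = (if k \<in> set ns then a k else b k)"
    unfolding T_def by blast+
qed

lemma swap_product_unitary: "set ns \<subseteq> \<Lambda> \<Longrightarrow> unitary_op (op_prod (map S ns))"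
  by (rule unitary_op_prod) (auto intro: site_swap_unitary)

lemma swap_product_eval_expr:
  assumes "distinct ns" "set ns = \<Lambda>" "set_expr e \<subseteq> \<Lambda>"
  shows "(op_prod (map S ns))\<^sup>\<dagger> ** eval_expr a e ** op_prod (map S ns) = eval_expr b e"
  by (rule eval_expr_conj) (use assms in \<open>auto simp: swap_product_modes swap_product_unitary\<close>)

lemma swap_product_square:
  assumes "distinct ns" "set ns \<subseteq> \<Lambda>"
  shows "op_prod (map S ns) ** op_prod (map S ns) = mat 1"
  using assms(2)
proof (induction ns)
  case (Cons n ns)
  let ?T = "op_prod (map S ns)"
  have "S n ** ?T = ?T ** S n"
    using Cons.prems by (intro op_prod_commute) (auto intro: site_swap_commute)
  then have "(?T ** S n) ** ?T = (S n ** ?T) ** ?T"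
    by simp
  then have "S n ** ?T ** (S n ** ?T) = S n ** S n ** (?T ** ?T)"
    by (simp only: matrix_mul_assoc[symmetric])
  then show ?case
    using Cons by (simp add: site_swap_square)
qed simp

end

section \<open>The decomposition\<close>

theorem theorem4p5:
  fixes \<Lambda> :: "'s set" and d :: "'s \<Rightarrow> 's \<Rightarrow> real"
    and a b :: "'s \<Rightarrow> ('h::finite) op" and c U\<^sub>A U\<^sub>B :: "'h op"
    and e :: "'s expr" and L :: real
  assumes "finite \<Lambda>" and "Metric_space \<Lambda> d"
    and "two_copies \<Lambda> a b" and "ancilla \<Lambda> a b c"
    and "set_expr e \<subseteq> \<Lambda>" and "U\<^sub>A = eval_expr a e" and "U\<^sub>B = eval_expr b e"
    and "unitary_op U\<^sub>A" and "fermionic c U\<^sub>A" and "causal_range \<Lambda> d a b L U\<^sub>A"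
  defines "S \<equiv> site_swap a b"
  defines "V \<equiv> (\<lambda>m. U\<^sub>B ** S m ** U\<^sub>B\<^sup>\<dagger>)"
  shows "(\<forall>ns ms. distinct ns \<and> set ns = \<Lambda> \<and> distinct ms \<and> set ms = \<Lambda> \<longrightarrow>
            U\<^sub>A ** U\<^sub>B\<^sup>\<dagger> = op_prod (map S ns) ** op_prod (map V ms)) \<and>
         (\<forall>n\<in>\<Lambda>. unitary_op (S n) \<and> fermionic c (S n) \<and> localized a b {n} (S n) \<and>
            swaps_modes_at \<Lambda> a b n (S n)) \<and>
         (\<forall>m\<in>\<Lambda>. unitary_op (V m) \<and> fermionic c (V m) \<and>
            localized a b {k \<in> \<Lambda>. d k m < L} (V m)) \<and>
         (\<forall>m\<in>\<Lambda>. \<forall>m'\<in>\<Lambda>. V m ** V m' = V m' ** V m)"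
proof -
  interpret two_copies_ancilla \<Lambda> a b c
    using assms(3,4) by unfold_locales
  interpret Metric_space \<Lambda> d
    by (rule assms(2))
  note S = site_swap_unitary[folded S_def] site_swap_hconj[folded S_def]
    site_swap_commute[folded S_def] site_swap_ancilla[folded S_def]
    site_swap_localized[folded S_def] site_swap_fermionic[folded S_def]
    site_swap_swaps_modes[folded S_def]
  \<comment> \<open>One enumeration serves to define \<open>T\<close>; by \<open>T_eq\<close> all
    others give the same operator.\<close>
  obtain ns where ns: "distinct ns" "set ns = \<Lambda>"
    using finite_distinct_list[OF assms(1)] by blast
  define T where "T = op_prod (map S ns)"
  have T: "unitary_op T"
    unfolding T_def S_def using ns by (intro swap_product_unitary) simp
  have TT: "T ** T = mat 1"
    unfolding T_def S_def using ns by (intro swap_product_square) simp_all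
  have T_eq: "op_prod (map S ms) = T" if "distinct ms" "set ms = \<Lambda>" for ms
    unfolding T_def
  proof (rule op_prod_permute)
    show "mset ms = mset ns"
      using that ns by (metis set_eq_iff_mset_eq_distinct)
  qed (use that S(3) in auto)
  have T_commute: "X ** T = T ** X" if "\<And>n. n \<in> \<Lambda> \<Longrightarrow> X ** S n = S n ** X" for X
    unfolding T_def using ns that by (intro op_prod_commute) auto
  \<comment> \<open>Exchanging the copies inside the expression \<open>e\<close> turns
    \<open>U\<^sub>A\<close> into \<open>U\<^sub>B\<close>, which thereby inherits unitarity and
    fermionicity.\<close>
  have U: "T\<^sup>\<dagger> ** U\<^sub>A ** T = U\<^sub>B"
    unfolding T_def S_def assms(6,7) by (rule swap_product_eval_expr) (use ns assms(5) in simp_all)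
  have UB: "unitary_op U\<^sub>B"
    unfolding U[symmetric] by (intro unitary_op_mult unitary_op_hconj T assms(8))
  have cT: "c ** T = T ** c"
    by (rule T_commute) (rule S(4))
  have cUB: "c ** U\<^sub>B = U\<^sub>B ** c"
  proof -
    have "c ** T\<^sup>\<dagger> = T\<^sup>\<dagger> ** c"
      by (rule unitary_hconj_commute[OF T cT])
    then show ?thesis
      unfolding U[symmetric]
      by (intro commute_mult cT fermionic_commute(1)[OF assms(8,9)])
  qed
  then have UB_fermionic: "fermionic c U\<^sub>B"
    by (simp add: fermionic_def unitary_conj_eq_iff UB)
  \<comment> \<open>\<open>U\<^sub>B\<close> is even in the modes \<open>b\<close> alone, so it
    commutes with the modes \<open>a\<close>, which anticommute with all of them.\<close>
  have UB_even: "graded (majorana b ` (\<Lambda> \<times> UNIV)) False U\<^sub>B"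
    unfolding assms(7)
    by (rule eval_expr_even[where c = c])
      (use assms(4,5,7) fermionic_commute[OF UB UB_fermionic] in \<open>auto simp: ancilla_def\<close>)
  have aUB: "a k ** U\<^sub>B = U\<^sub>B ** a k" if "k \<in> \<Lambda>" for k
    using UB_even by (rule graded_even_commute)
      (use that in \<open>auto intro!: majorana_anticommute_modes simp: acomm_modes\<close>)

  have V_unitary: "unitary_op (V m)" if "m \<in> \<Lambda>" for m
    unfolding V_def by (intro unitary_op_mult unitary_op_hconj UB S that)
  have V_hconj: "(V m)\<^sup>\<dagger> = V m" if "m \<in> \<Lambda>" for m
    by (simp add: V_def S(2)[OF that] matrix_mul_assoc)
  \<comment> \<open>Commutation with \<open>V m\<close> is tested after conjugation by
    \<open>U\<^sub>B\<close>, which turns \<open>V m\<close> into \<open>S m\<close>.\<close>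
  have V_commute: "X ** V m = V m ** X" if "(U\<^sub>B\<^sup>\<dagger> ** X ** U\<^sub>B) ** S m = S m ** (U\<^sub>B\<^sup>\<dagger> ** X ** U\<^sub>B)" for X m
  proof -
    have "X ** V m = U\<^sub>B ** ((U\<^sub>B\<^sup>\<dagger> ** X ** U\<^sub>B) ** S m) ** U\<^sub>B\<^sup>\<dagger>"
      by (simp add: V_def unitary_cancel[OF UB] matrix_mul_assoc[symmetric])
    also have "\<dots> = V m ** X"
      unfolding that by (simp add: V_def unitary_cancel[OF UB] matrix_mul_assoc[symmetric])
    finally show ?thesis .
  qed
  have V_c: "c ** V m = V m ** c" if "m \<in> \<Lambda>" for m
    by (rule V_commute) (use UB_fermionic S(4)[OF that] in \<open>simp add: fermionic_def\<close>)
  then have V_fermionic: "fermionic c (V m)" if "m \<in> \<Lambda>" for m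
    using that V_unitary by (simp add: fermionic_def unitary_conj_eq_iff)
  have V_localized: "localized a b {k \<in> \<Lambda>. d k m < L} (V m)" if m: "m \<in> \<Lambda>" for m
  proof -
    have loc: "localized a b {j \<in> \<Lambda>. d k j < L} (U\<^sub>A\<^sup>\<dagger> ** a k ** U\<^sub>A)" if "k \<in> \<Lambda>" for k
      using assms(10) that by (simp add: causal_range_def)
    \<comment> \<open>Ensures that \<open>m\<close> lies in its own region. Otherwise the evolved
      \<open>a m\<close> would be localized on the empty set and commute with everything, in
      particular with its adjoint; then \<open>a m\<close> would be normal with square zero, hence
      zero, against the anticommutation relations.\<close>
    have "L > 0"
    proof (rule ccontr)
      assume "\<not> L > 0"
      then have "{j \<in> \<Lambda>. d m j < L} = {}"
        by (auto simp: not_less intro: order_trans[OF _ nonneg])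
      then have "localized a b {} (U\<^sub>A\<^sup>\<dagger> ** a m ** U\<^sub>A)"
        using loc[OF m] by (simp only:)
      then have "X ** (U\<^sub>A\<^sup>\<dagger> ** a m ** U\<^sub>A) = (U\<^sub>A\<^sup>\<dagger> ** a m ** U\<^sub>A) ** X" for X
        by (rule localized_commute) simp_all
      then have "U\<^sub>A\<^sup>\<dagger> ** ((a m)\<^sup>\<dagger> ** a m) ** U\<^sub>A = U\<^sub>A\<^sup>\<dagger> ** (a m ** (a m)\<^sup>\<dagger>) ** U\<^sub>A"
        unfolding unitary_conj_mult[OF assms(8)] .
      then have comm: "(a m)\<^sup>\<dagger> ** a m = a m ** (a m)\<^sup>\<dagger>"
        by (simp only: unitary_conj_inject[OF assms(8)])
      have sq: "a m ** a m = 0"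
        using acomm_modes(1)[OF m m] unfolding acomm_def by (rule op_double_eq_0_iff[THEN iffD1])
      have one: "a m ** (a m)\<^sup>\<dagger> + (a m)\<^sup>\<dagger> ** a m = mat 1"
        using acomm_modes(13)[OF m m] by (simp add: acomm_def)
      have "a m = a m ** (a m ** (a m)\<^sup>\<dagger> + (a m)\<^sup>\<dagger> ** a m)"
        by (simp add: one)
      also have "\<dots> = 0"
        unfolding comm by (simp only: matrix_add_ldistrib matrix_mul_assoc sq op_zero_left add_0_right)
      finally have "a m = 0" .
      then show False
        using one by (simp add: mat_neq_0)
    qed
    \<comment> \<open>\<open>U\<^sub>B\<close> fixes \<open>a k\<close>, and so does the swap at
      \<open>m\<close>, as \<open>k\<close> differs from \<open>m\<close>.\<close>
    have a: "V m ** a k = a k ** V m" if k: "k \<in> \<Lambda>" "d k m \<ge> L" for k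
    proof -
      have "k \<noteq> m"
        using k m \<open>L > 0\<close> by auto
      then have "S m ** a k = a k ** S m"
        unfolding S_def using k m by (intro site_swap_other_site)
      moreover have "U\<^sub>B\<^sup>\<dagger> ** a k ** U\<^sub>B = a k"
        using aUB[OF k(1)] by (simp add: unitary_conj_eq_iff UB)
      ultimately show ?thesis
        by (intro V_commute[symmetric]) simp
    qed
    \<comment> \<open>The evolution of \<open>b k\<close> under \<open>U\<^sub>B\<close> is the
      conjugate by \<open>T\<close> of the evolution of \<open>a k\<close> under
      \<open>U\<^sub>A\<close>. The latter is localized away from \<open>m\<close>, hence commutes
      with \<open>S m\<close>, and \<open>T\<close> commutes with \<open>S m\<close> too.\<close>
    have b: "V m ** b k = b k ** V m" if k: "k \<in> \<Lambda>" "d k m \<ge> L" for k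
    proof -
      let ?Y = "U\<^sub>A\<^sup>\<dagger> ** a k ** U\<^sub>A"
      have ne: "j \<noteq> m" if "j \<in> {j \<in> \<Lambda>. d k j < L}" for j
        using that k by auto
      have Y: "S m ** ?Y = ?Y ** S m"
        using loc[OF k(1)] unfolding S_def
        by (rule localized_commute) (use m ne in \<open>blast intro: site_swap_other_site\<close>)+
      have Tb: "T ** b k ** T\<^sup>\<dagger> = a k"
      proof -
        have "T\<^sup>\<dagger> ** a k ** T = b k"
          unfolding T_def S_def using swap_product_modes(1)[OF ns(1)] ns(2) k(1) by simp
        then show ?thesis
          by (simp add: unitary_cancel[OF T] matrix_mul_assoc[symmetric] flip: \<open>T\<^sup>\<dagger> ** a k ** T = b k\<close>)
      qed
      have "U\<^sub>B\<^sup>\<dagger> ** b k ** U\<^sub>B = T\<^sup>\<dagger> ** (U\<^sub>A\<^sup>\<dagger> ** (T ** b k ** T\<^sup>\<dagger>) ** U\<^sub>A) ** T"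
        by (simp add: U[symmetric] matrix_mul_assoc)
      then have eq: "U\<^sub>B\<^sup>\<dagger> ** b k ** U\<^sub>B = T\<^sup>\<dagger> ** ?Y ** T"
        by (simp only: Tb)
      have ST: "S m ** T = T ** S m"
        by (rule T_commute) (use S(3) m in blast)
      then have ST': "S m ** T\<^sup>\<dagger> = T\<^sup>\<dagger> ** S m"
        by (rule unitary_hconj_commute[OF T])
      have "S m ** (U\<^sub>B\<^sup>\<dagger> ** b k ** U\<^sub>B) = (U\<^sub>B\<^sup>\<dagger> ** b k ** U\<^sub>B) ** S m"
        unfolding eq by (intro commute_mult ST ST' Y)
      then show ?thesis
        by (intro V_commute[symmetric]) simp
    qed
    \<comment> \<open>\<open>V m\<close> is self-adjoint, so relations for annihilation operators
      yield those for creation operators.\<close>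
    have adj: "V m ** X\<^sup>\<dagger> = X\<^sup>\<dagger> ** V m" if "V m ** X = X ** V m" for X
      using arg_cong[OF that, of hconj] by (simp add: V_hconj[OF m])
    \<comment> \<open>The commutant argument starts from localization on the whole lattice, which
      follows because all factors of \<open>V m\<close> are expressions in the modes.\<close>
    have loc_UB: "localized a b \<Lambda> U\<^sub>B"
      unfolding assms(7) by (rule localized_second_copy) (rule assms(5))
    show ?thesis
    proof (rule even_localized_commutant[OF assms(1,3,4)])
      show "localized a b \<Lambda> (V m)"
        unfolding V_def
        by (intro localized_mult localized_hconj loc_UB localized_mono[OF S(5)[OF m]]) (use m in simp)
      show "c ** V m = V m ** c" "c\<^sup>\<dagger> ** V m = V m ** c\<^sup>\<dagger>"
        using fermionic_commute[OF V_unitary V_fermionic] m by blast+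
    qed (auto simp: not_less intro!: a b adj)
  qed
  have decomposition: "U\<^sub>A ** U\<^sub>B\<^sup>\<dagger> = op_prod (map S ms) ** op_prod (map V ms')"
    if "distinct ms" "set ms = \<Lambda>" "distinct ms'" "set ms' = \<Lambda>" for ms ms'
  proof -
    have "op_prod (map V ms') = U\<^sub>B ** T ** U\<^sub>B\<^sup>\<dagger>"
      unfolding V_def conj_op_prod[OF UB] T_eq[OF that(3,4)] ..
    \<comment> \<open>Only the first \<open>U\<^sub>B\<close> is replaced by
      \<open>T\<^sup>\<dagger> U\<^sub>A T\<close>; then \<open>T T\<^sup>\<dagger> = 1\<close> and
      \<open>T T = 1\<close> remove the swaps.\<close>
    moreover have "T ** (U\<^sub>B ** T ** U\<^sub>B\<^sup>\<dagger>) = (T ** T\<^sup>\<dagger>) ** U\<^sub>A ** (T ** T) ** U\<^sub>B\<^sup>\<dagger>"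
      by (subst (1) U[symmetric]) (simp only: matrix_mul_assoc)
    ultimately show ?thesis
      using T by (simp add: T_eq[OF that(1,2)] TT unitary_op_def)
  qed
  have V_commutes: "V m ** V m' = V m' ** V m" if "m \<in> \<Lambda>" "m' \<in> \<Lambda>" for m m'
  proof (rule V_commute)
    have "U\<^sub>B\<^sup>\<dagger> ** V m ** U\<^sub>B = S m"
      by (simp add: V_def unitary_cancel[OF UB] matrix_mul_assoc[symmetric])
    then show "(U\<^sub>B\<^sup>\<dagger> ** V m ** U\<^sub>B) ** S m' = S m' ** (U\<^sub>B\<^sup>\<dagger> ** V m ** U\<^sub>B)"
      using S(3) that by simp
  qed
  show ?thesis
    by (intro conjI allI impI ballI; (elim conjE)?)
      (assumption | rule decomposition V_commutes S(1,5-7) V_unitary V_fermionic V_localized)+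
qed

end
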